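(* For every integer $m\ge 3$, the arc set of the directed graph $D_3(m)$ can be partitioned into three arc-disjoint directed Hamilton cycles.
   Context: Fix an integer $m\ge 3$ and write $\mathbb Z_m=\mathbb Z/m\mathbb Z$. Let $V=(\mathbb Z_m)^3$ and let $e_1=(1,0,0)$, $e_2=(0,1,0)$, $e_3=(0,0,1)$. The directed graph $D_3(m)$ (the Cayley digraph $\mathrm{Cay}((\mathbb Z_m)^3,\{e_1,e_2,e_3\})$, equivalently the Cartesian product of three directed $m$-cycles) has vertex set $V$ and the $3m^3$ arcs $v\to v+e_1$, $v\to v+e_2$, $v\to v+e_3$ for $v\in V$ (arithmetic mod $m$). A directed Hamilton cycle is a directed cycle through all $m^3$ vertices. *)

theory Defs
  imports "Graph_Theory.Graph_Theory"
begin

text \<open>A closed walk is given by its list of arcs, so the vertices it visits are the tails of its arcs.\<close>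

definition (in pre_digraph) hamilton_cycle :: "'b awalk \<Rightarrow> bool" where
  "hamilton_cycle p \<longleftrightarrow> cycle p \<and> tail G ` set p = verts G"

text \<open>Elements of $\mathbb{Z}_m$ are represented by their residues in \<open>{0..<m}\<close>.\<close>

type_synonym int3 = "int \<times> int \<times> int"

definition Zm3 :: "int \<Rightarrow> int3 set" where
  "Zm3 m = {0..<m} \<times> {0..<m} \<times> {0..<m}"

fun add3 :: "int \<Rightarrow> int3 \<Rightarrow> int3 \<Rightarrow> int3" where
  "add3 m (x, y, z) (x', y', z') = ((x + x') mod m, (y + y') mod m, (z + z') mod m)"

definition e1 :: int3 where "e1 = (1, 0, 0)"
definition e2 :: int3 where "e2 = (0, 1, 0)"
definition e3 :: int3 where "e3 = (0, 0, 1)"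

text \<open>For \<open>m \<ge> 2\<close> the three generators are distinct in $\mathbb{Z}_m^3$, so no two arcs are
  parallel and an arc is determined by its pair of end points.\<close>

definition D3 :: "int \<Rightarrow> int3 pair_pre_digraph" where
  "D3 m = \<lparr> pverts = Zm3 m, parcs = {(v, add3 m v e) | v e. v \<in> Zm3 m \<and> e \<in> {e1, e2, e3}} \<rparr>"

end

theory Submission
  imports Defs "HOL-Number_Theory.Cong"
begin

text \<open>
  A vertex \<open>(x, y, z)\<close> lies in layer \<open>s = x + y + z\<close>, and every arc leads from one layer to the
  next. At each vertex the three outgoing arcs are distributed among three colours, so that each
  colour class is the graph of a map; the theorem follows once each of these maps is a single cycle.
  For odd \<open>m\<close>, a colouring depending only on \<open>s\<close> and \<open>x + y\<close> makes each map an iterated skew product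
  of rotations of $\mathbb{Z}_m$, which is a single cycle because the total rotations are units.

  For even \<open>m\<close> a single cycle on $\mathbb{Z}_m^2$ is an odd permutation, so the three return maps to
  layer \<open>0\<close> must all be odd. Exchanging two colours along a closed alternating walk of a layer never
  changes the product of their three signs, which is \<open>1\<close> for the constant colouring. Hence one layer
  has to carry a colouring not obtained by such exchanges: there, three lines of exchanged colours
  (\<open>x = 0\<close>, \<open>y = 0\<close> and \<open>x + y = 0\<close>) meet in a small defect around the origin. Each return map then
  drifts along parallel lines and moves from line to line in a controlled order.
\<close>

section \<open>Cyclic maps\<close>

text \<open>The orbit of \<open>p\<close> is a set that contains \<open>f p\<close> and is closed
  under \<open>f\<close>, so a cycle may be proved by following it point by point inside an
  arbitrary such set \<open>A\<close>. Since \<open>A\<close> starts at \<open>f p\<close> and not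
  at \<open>p\<close>, covering \<open>p\<close> amounts to closing the cycle.\<close>

lemma cyclic_on_if_covered:
  assumes "p \<in> X" "\<And>x. x \<in> X \<Longrightarrow> f x \<in> X"
    and "\<And>A. f p \<in> A \<Longrightarrow> (\<And>x. x \<in> X \<Longrightarrow> x \<in> A \<Longrightarrow> f x \<in> A) \<Longrightarrow> X \<subseteq> A"
  shows "cyclic_on f X"
proof -
  have "X \<subseteq> orbit f p" by (rule assms(3)) (auto intro: orbit.intros)
  moreover have "x \<in> X" if "x \<in> orbit f p" for x
    using that by induction (auto intro: assms(1,2))
  ultimately show ?thesis unfolding cyclic_on_def using assms(1) by blast
qed

text \<open>The first return time of \<open>x\<close> is \<open>card X\<close>, because the iterates
  before it are distinct and exhaust the orbit.\<close>

lemma cyclic_on_card_funpow: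
  assumes "cyclic_on f X" "x \<in> X"
  shows "(f ^^ card X) x = x" "(\<lambda>k. (f ^^ k) x) ` {0..<card X} = X"
    "inj_on (\<lambda>k. (f ^^ k) x) {0..<card X}"
proof -
  let ?n = "funpow_dist1 f x x"
  have X: "X = orbit f x" and x: "x \<in> orbit f x"
    using assms by (simp_all add: orbit_cyclic_eq3)
  have inj: "inj_on (\<lambda>k. (f ^^ k) x) {0..<?n}" by (rule inj_on_funpow_dist1[OF x])
  have im: "X = (\<lambda>k. (f ^^ k) x) ` {0..<?n}"
    unfolding X by (rule orbit_conv_funpow_dist1[OF x])
  have n: "card X = ?n" by (subst im) (simp only: card_image[OF inj] card_atLeastLessThan diff_zero)
  show "(f ^^ card X) x = x" using funpow_dist1_prop[OF x] n by simp
  show "(\<lambda>k. (f ^^ k) x) ` {0..<card X} = X" using im n by simp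
  show "inj_on (\<lambda>k. (f ^^ k) x) {0..<card X}" using inj n by simp
qed

lemma cyclic_on_inj_on:
  assumes "cyclic_on f X" shows "inj_on f X"
proof (rule inj_onI)
  fix x y assume xy: "x \<in> X" "y \<in> X" "f x = f y"
  \<comment> \<open>On \<open>X\<close> the power \<open>f ^^ (card X - 1)\<close> is a left inverse
    of \<open>f\<close>.\<close>
  have *: "(f ^^ (card X - 1)) (f z) = z" if "z \<in> X" for z
  proof -
    have "card X > 0" using finite_cyclic_on[OF assms] that card_gt_0_iff by blast
    then have "(f ^^ (card X - 1)) (f z) = (f ^^ card X) z"
      by (cases "card X") (simp_all add: funpow_swap1)
    then show ?thesis using cyclic_on_card_funpow(1)[OF assms that] by simp
  qed
  show "x = y" using *[OF xy(1)] *[OF xy(2)] xy(3) by simp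
qed

definition skew :: "int \<Rightarrow> ('a \<Rightarrow> 'a) \<Rightarrow> ('a \<Rightarrow> int) \<Rightarrow> 'a \<times> int \<Rightarrow> 'a \<times> int" where
  "skew m f g = (\<lambda>(x, j). (f x, (j + g x) mod m))"

lemma skew_funpow:
  "(skew m f g ^^ n) (x, j mod m) = ((f ^^ n) x, (j + (\<Sum>k<n. g ((f ^^ k) x))) mod m)"
  by (induction n) (simp_all add: skew_def mod_add_left_eq add.assoc)

text \<open>One tour of the base returns to \<open>x\<close> and rotates its fibre by the sum of all
  \<open>g\<close>. This total is a unit modulo \<open>m\<close>, so repeated tours exhaust the
  fibre over \<open>x\<close>, and a partial tour then leads to any other fibre.\<close>

lemma cyclic_on_skew:
  assumes f: "cyclic_on f X" and m: "m > 0" and g: "coprime (\<Sum>x\<in>X. g x) m"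
  shows "cyclic_on (skew m f g) (X \<times> {0..<m})"
proof -
  obtain x where x: "x \<in> X" using f by (auto simp: cyclic_on_def)
  let ?N = "card X" and ?G = "\<Sum>x\<in>X. g x" and ?F = "skew m f g"
  have loop: "(?F ^^ ?N) (x, j mod m) = (x, (j + ?G) mod m)" for j
  proof -
    have "?G = (\<Sum>k<?N. g ((f ^^ k) x))"
      by (subst (1) cyclic_on_card_funpow(2)[OF f x, symmetric])
        (simp add: sum.reindex[OF cyclic_on_card_funpow(3)[OF f x]] lessThan_atLeast0)
    then show ?thesis using cyclic_on_card_funpow(1)[OF f x] by (simp add: skew_funpow)
  qed
  have loops: "((?F ^^ ?N) ^^ t) (x, j mod m) = (x, (j + int t * ?G) mod m)" for t j
    by (induction t) (simp_all add: loop algebra_simps)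
  show ?thesis
  proof (rule cyclic_on_singleI)
    show "(x, 0) \<in> X \<times> {0..<m}" using x m by simp
    show "X \<times> {0..<m} = orbit ?F (x, 0)"
    proof (intro equalityI subsetI)
      fix v assume "v \<in> X \<times> {0..<m}"
      then obtain y j where v: "v = (y, j)" "y \<in> X" "0 \<le> j" "j < m" by auto
      obtain k where k: "k > 0" "(f ^^ k) x = y"
        using v(2) orbit_cyclic_eq3[OF f x] by (auto simp: orbit_altdef)
      let ?o = "\<Sum>i<k. g ((f ^^ i) x)"
      obtain c where c: "[?G * c = 1] (mod m)"
        using g cong_solve_coprime_int by blast
      \<comment> \<open>The number \<open>t\<close> of full tours solves
        \<open>t * ?G + ?o = j\<close> modulo \<open>m\<close>, where \<open>?o\<close> is the
        rotation collected on the partial tour from \<open>x\<close> to \<open>y\<close>.\<close>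
      define t where "t = nat (((j - ?o) * c) mod m)"
      have "[int t * ?G = (j - ?o) * c * ?G] (mod m)"
        using m by (simp add: t_def cong_def mod_mult_left_eq)
      also have "[(j - ?o) * c * ?G = (j - ?o) * 1] (mod m)"
        unfolding mult.assoc using c by (intro cong_scalar_left) (simp add: mult.commute)
      finally have t: "[int t * ?G + ?o = j] (mod m)"
        by (metis cong_add_rcancel diff_add_cancel mult.right_neutral)
      have "(?F ^^ (k + ?N * t)) (x, 0) = (?F ^^ k) (((?F ^^ ?N) ^^ t) (x, 0 mod m))"
        by (simp add: funpow_add funpow_mult)
      also have "\<dots> = (y, (int t * ?G + ?o) mod m)"
        unfolding loops skew_funpow k(2) by simp
      also have "\<dots> = v" using t v by (simp add: cong_def)
      finally show "v \<in> orbit ?F (x, 0)" using k(1) unfolding orbit_altdef by force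
    next
      fix v assume "v \<in> orbit ?F (x, 0)"
      then show "v \<in> X \<times> {0..<m}"
        by induction (auto simp: skew_def m x intro: cyclic_on_inI[OF f])
    qed
  qed
qed

lemma cyclic_on_rotation:
  assumes "m > 0" "coprime a m"
  shows "cyclic_on (\<lambda>j. (j + a) mod m) {0..<m::int}"
proof -
  \<comment> \<open>A rotation is a skew product over a base of one point.\<close>
  have "cyclic_on id {()}" by (intro cyclic_on_singleI[of "()"]) (use orbit.base[of id "()"] in auto)
  then have "cyclic_on (skew m id (\<lambda>_. a)) ({()} \<times> {0..<m})"
    by (rule cyclic_on_skew) (use assms in auto)
  then have "cyclic_on (\<lambda>j. (j + a) mod m) (snd ` ({()} \<times> {0..<m}))"
    by (rule cyclic_on_image) (auto simp: skew_def)
  then show ?thesis by simp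
qed

text \<open>As \<open>R\<close> is injective, so is the climb from level \<open>0\<close> to each
  level \<open>s\<close>. By counting, every point lies on the climb from some point of level
  \<open>0\<close>, and all points of level \<open>0\<close> lie in one orbit.\<close>

lemma cyclic_on_tower:
  fixes m :: nat
  assumes R: "cyclic_on R Y" and m: "m > 0"
    and step: "\<And>y s. y \<in> Y \<Longrightarrow> s < m \<Longrightarrow> fst (F (y, s)) \<in> Y \<and> snd (F (y, s)) = Suc s mod m"
    and return: "\<And>y. y \<in> Y \<Longrightarrow> (F ^^ m) (y, 0) = (R y, 0)"
  shows "cyclic_on F (Y \<times> {0..<m})"
proof -
  let ?X = "Y \<times> {0..<m}"
  obtain p where p: "p \<in> Y" using R by (auto simp: cyclic_on_def)
  have climb: "fst ((F ^^ k) (y, 0)) \<in> Y \<and> snd ((F ^^ k) (y, 0)) = k mod m" if "y \<in> Y" for y k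
  proof (induction k)
    case (Suc k)
    then show ?case using step[of "fst ((F ^^ k) (y, 0))" "k mod m"] m
      by (simp add: mod_Suc_eq) (metis prod.collapse mod_Suc_eq)
  qed (use that in simp)
  define H where "H = (\<lambda>(y, s). (F ^^ s) (y, 0::nat))"
  have H: "H ` ?X \<subseteq> ?X"
  proof
    fix v assume "v \<in> H ` ?X"
    then obtain y s where "y \<in> Y" "v = (F ^^ s) (y, 0)" by (auto simp: H_def)
    then show "v \<in> ?X" using climb[of y s] m by (simp add: mem_Times_iff)
  qed
  have "inj_on H ?X"
  proof (rule inj_onI)
    fix u v assume uv: "u \<in> ?X" "v \<in> ?X" "H u = H v"
    obtain y s z t where [simp]: "u = (y, s)" "v = (z, t)" by (cases u, cases v)
    have [simp]: "t = s" using climb[of y s] climb[of z t] uv by (auto simp: H_def)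
    \<comment> \<open>Completing the tour of the levels turns equal points of level \<open>s\<close>
      into equal values of \<open>R\<close>.\<close>
    have "(F ^^ (m - s)) (H (x, s)) = (R x, 0)" if "x \<in> Y" for x
      using uv return[OF that] by (simp add: H_def funpow_add[symmetric, THEN fun_cong, unfolded o_apply])
    from this[of y] this[of z] have "R y = R z" using uv by simp
    then show "u = v" using cyclic_on_inj_on[OF R] uv by (auto dest: inj_onD)
  qed
  moreover have fin: "finite ?X" using finite_cyclic_on[OF R] by simp
  ultimately have H_surj: "H ` ?X = ?X" using endo_inj_surj[OF fin H] by simp
  have "(y, 0) \<in> orbit F (p, 0)" if "y \<in> Y" for y
  proof -
    have "y \<in> orbit R p" using orbit_cyclic_eq3[OF R p] that by simp
    then show ?thesis
    proof induction
      case base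
      then show ?case using return[OF p] m unfolding orbit_altdef by force
    next
      case (step y)
      then have "y \<in> Y" using orbit_cyclic_eq3[OF R p] by simp
      then show ?case using funpow_in_orbit[OF step(2), of m] return by simp
    qed
  qed
  then have H_orbit: "H u \<in> orbit F (p, 0)" if "u \<in> ?X" for u
    using that by (cases u) (simp add: H_def funpow_in_orbit)
  have "?X \<subseteq> orbit F (p, 0)"
  proof
    fix v assume "v \<in> ?X"
    then have "v \<in> H ` ?X" by (simp only: H_surj)
    then show "v \<in> orbit F (p, 0)" by (rule imageE) (simp only: H_orbit)
  qed
  moreover have "orbit F (p, 0) \<subseteq> ?X"
  proof
    fix v assume "v \<in> orbit F (p, 0)"
    then obtain k where "v = (F ^^ k) (p, 0)" by (auto simp: orbit_altdef)
    then show "v \<in> ?X" using climb[OF p, of k] m by (simp add: mem_Times_iff)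
  qed
  ultimately have "?X = orbit F (p, 0)" by (rule equalityI)
  moreover have "(p, 0) \<in> ?X" using p m by simp
  ultimately show ?thesis by (intro cyclic_on_singleI)
qed

section \<open>Hamilton cycles from cyclic maps\<close>

primrec orbit_walk :: "('a \<Rightarrow> 'a) \<Rightarrow> nat \<Rightarrow> 'a \<Rightarrow> ('a \<times> 'a) list" where
  "orbit_walk f 0 x = []"
| "orbit_walk f (Suc n) x = (x, f x) # orbit_walk f n (f x)"

lemma cas_orbit_walk: "pre_digraph.cas (with_proj G) x (orbit_walk f n x) ((f ^^ n) x)"
  by (induction n arbitrary: x) (simp_all add: funpow_swap1 pre_digraph.cas.simps)

lemma awalk_verts_orbit_walk:
  "pre_digraph.awalk_verts (with_proj G) x (orbit_walk f n x) = map (\<lambda>k. (f ^^ k) x) [0..<Suc n]"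
proof (induction n arbitrary: x)
  case (Suc n)
  have "map (\<lambda>k. (f ^^ k) x) [0..<Suc (Suc n)] = x # map (\<lambda>k. (f ^^ k) (f x)) [0..<Suc n]"
    by (simp add: map_upt_Suc funpow_swap1 del: upt_Suc)
  then show ?case using Suc[of "f x"] by (simp add: pre_digraph.awalk_verts.simps del: upt_Suc)
qed (simp add: pre_digraph.awalk_verts.simps)

lemma set_orbit_walk: "set (orbit_walk f n x) = (\<lambda>k. ((f ^^ k) x, f ((f ^^ k) x))) ` {0..<n}"
proof (induction n arbitrary: x)
  case (Suc n)
  then show ?case using Suc[of "f x"]
    by (simp add: atLeast0_lessThan_Suc_eq_insert_0 image_image funpow_swap1
        del: image_Suc_atLeastLessThan)
qed simp

lemma hamilton_cycle_if_cyclic_on: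
  assumes f: "cyclic_on f (pverts G)" and arcs: "\<And>v. v \<in> pverts G \<Longrightarrow> (v, f v) \<in> parcs G"
  shows "\<exists>C. pre_digraph.hamilton_cycle (with_proj G) C \<and> set C = (\<lambda>v. (v, f v)) ` pverts G"
proof -
  let ?V = "pverts G"
  obtain x where x: "x \<in> ?V" using f by (auto simp: cyclic_on_def)
  note orb = cyclic_on_card_funpow[OF f x]
  let ?C = "orbit_walk f (card ?V) x"
  have card: "card ?V > 0" using finite_cyclic_on[OF f] x card_gt_0_iff by blast
  have set: "set ?C = (\<lambda>v. (v, f v)) ` ?V"
    by (subst (2) orb(2)[symmetric]) (simp add: set_orbit_walk image_image)
  have "pre_digraph.awalk (with_proj G) x ?C x"
    using cas_orbit_walk[of G x f "card ?V"] orb(1) x arcs set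
    by (auto simp: pre_digraph.awalk_def)
  \<comment> \<open>The first vertex recurs at the end of the walk, so only the vertices after it
    are compared; they are the images under \<open>f\<close> of the first \<open>card ?V\<close>
    iterates.\<close>
  moreover have "distinct (tl (pre_digraph.awalk_verts (with_proj G) x ?C))"
  proof -
    have "tl (map (\<lambda>k. (f ^^ k) x) [0..<Suc (card ?V)]) = map (\<lambda>k. f ((f ^^ k) x)) [0..<card ?V]"
      by (simp only: upt_conv_Cons[of 0 "Suc (card ?V)"] list.map list.sel map_Suc_upt[symmetric] map_map)
        (simp add: comp_def)
    moreover have "inj_on (\<lambda>k. f ((f ^^ k) x)) {0..<card ?V}"
      using comp_inj_on[OF orb(3), of f] orb(2) cyclic_on_inj_on[OF f] by (simp add: comp_def)
    ultimately show ?thesis by (simp only: awalk_verts_orbit_walk distinct_map) simp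
  qed
  moreover have "?C \<noteq> []" using card by (cases "card ?V") auto
  ultimately have "pre_digraph.cycle (with_proj G) ?C"
    unfolding pre_digraph.cycle_def by blast
  then have "pre_digraph.hamilton_cycle (with_proj G) ?C"
    by (simp add: pre_digraph.hamilton_cycle_def set image_image)
  then show ?thesis using set by blast
qed

lemma e_distinct [simp]: "e1 \<noteq> e2" "e1 \<noteq> e3" "e2 \<noteq> e3" "e2 \<noteq> e1" "e3 \<noteq> e1" "e3 \<noteq> e2"
  by (simp_all add: e1_def e2_def e3_def)

text \<open>The generators change different coordinates, and adding \<open>1\<close> modulo
  \<open>m\<close> really changes a coordinate when \<open>m \<ge> 2\<close>.\<close>

lemma add3_generator_inject:
  assumes "m \<ge> 2" "v \<in> Zm3 m" "d \<in> {e1, e2, e3}" "e \<in> {e1, e2, e3}" "add3 m v d = add3 m v e"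
  shows "d = e"
proof -
  have "(x + 1) mod m \<noteq> x" if "0 \<le> x" "x < m" for x :: int
    using that assms(1) by (cases "x + 1 = m") auto
  then show ?thesis using assms by (cases v) (auto simp: Zm3_def e1_def e2_def e3_def)
qed

lemma parcs_D3: "parcs (D3 m) = (\<Union>v\<in>Zm3 m. (\<lambda>e. (v, add3 m v e)) ` {e1, e2, e3})"
  unfolding D3_def pair_pre_digraph.select_convs by blast

lemma pverts_D3: "pverts (D3 m) = Zm3 m"
  by (simp add: D3_def)

text \<open>The colour classes are graphs of maps. They are disjoint and exhaust the arcs because
  each vertex gives the three generators to the three colours bijectively.\<close>

lemma hamilton_decomposition_if_cyclic_on:
  fixes m :: int
  assumes m: "m \<ge> 2"
    and dirs: "\<And>v. v \<in> Zm3 m \<Longrightarrow> {a v, b v, c v} = {e1, e2, e3}"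
    and cyclic: "cyclic_on (\<lambda>v. add3 m v (a v)) (Zm3 m)" "cyclic_on (\<lambda>v. add3 m v (b v)) (Zm3 m)"
      "cyclic_on (\<lambda>v. add3 m v (c v)) (Zm3 m)"
  shows "\<exists>C1 C2 C3.
    pre_digraph.hamilton_cycle (with_proj (D3 m)) C1 \<and>
    pre_digraph.hamilton_cycle (with_proj (D3 m)) C2 \<and>
    pre_digraph.hamilton_cycle (with_proj (D3 m)) C3 \<and>
    set C1 \<inter> set C2 = {} \<and> set C1 \<inter> set C3 = {} \<and> set C2 \<inter> set C3 = {} \<and>
    set C1 \<union> set C2 \<union> set C3 = arcs (with_proj (D3 m))"
proof -
  define A where "A d = (\<lambda>v. (v, add3 m v (d v))) ` Zm3 m" for d :: "int3 \<Rightarrow> int3"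
  have ham: "\<exists>C. pre_digraph.hamilton_cycle (with_proj (D3 m)) C \<and> set C = A d"
    if "cyclic_on (\<lambda>v. add3 m v (d v)) (Zm3 m)" "\<And>v. v \<in> Zm3 m \<Longrightarrow> d v \<in> {e1, e2, e3}" for d
  proof -
    have "(v, add3 m v (d v)) \<in> parcs (D3 m)" if "v \<in> pverts (D3 m)" for v
      using that \<open>\<And>v. v \<in> Zm3 m \<Longrightarrow> d v \<in> {e1, e2, e3}\<close> unfolding parcs_D3 pverts_D3 by blast
    then show ?thesis
      using hamilton_cycle_if_cyclic_on[of "\<lambda>v. add3 m v (d v)" "D3 m"] that(1)
      unfolding A_def pverts_D3 by blast
  qed
  have dist: "a v \<noteq> b v \<and> a v \<noteq> c v \<and> b v \<noteq> c v" if "v \<in> Zm3 m" for v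
  proof -
    have "card {a v, b v, c v} = 3"
      unfolding dirs[OF that] by simp
    then show ?thesis by (auto simp: card_insert_if split: if_splits)
  qed
  have disj: "A d \<inter> A d' = {}"
    if "\<And>v. v \<in> Zm3 m \<Longrightarrow> d v \<in> {e1, e2, e3} \<and> d' v \<in> {e1, e2, e3} \<and> d v \<noteq> d' v" for d d'
  proof (rule equals0I)
    fix w assume "w \<in> A d \<inter> A d'"
    then obtain v v' where "v \<in> Zm3 m" "w = (v, add3 m v (d v))" "w = (v', add3 m v' (d' v'))"
      unfolding A_def by blast
    then have v: "v \<in> Zm3 m" "add3 m v (d v) = add3 m v (d' v)" by auto
    show False using add3_generator_inject[OF m v(1) _ _ v(2)] that[OF v(1)] by metis
  qed
  have "A a \<union> A b \<union> A c = (\<Union>v\<in>Zm3 m. (\<lambda>e. (v, add3 m v e)) ` {a v, b v, c v})"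
    unfolding A_def by blast
  also have "\<dots> = arcs (with_proj (D3 m))"
    unfolding with_proj_simps parcs_D3 by (rule SUP_cong[OF refl]) (simp only: dirs)
  finally have all_arcs: "A a \<union> A b \<union> A c = arcs (with_proj (D3 m))" .
  have mem: "a v \<in> {e1, e2, e3} \<and> b v \<in> {e1, e2, e3} \<and> c v \<in> {e1, e2, e3}"
    if "v \<in> Zm3 m" for v
    using dirs[OF that] by blast
  obtain C1 C2 C3 where C:
    "pre_digraph.hamilton_cycle (with_proj (D3 m)) C1" "set C1 = A a"
    "pre_digraph.hamilton_cycle (with_proj (D3 m)) C2" "set C2 = A b"
    "pre_digraph.hamilton_cycle (with_proj (D3 m)) C3" "set C3 = A c"
    using ham[OF cyclic(1)] ham[OF cyclic(2)] ham[OF cyclic(3)] mem by blast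
  have "A a \<inter> A b = {}" "A a \<inter> A c = {}" "A b \<inter> A c = {}"
    using disj[of a b] disj[of a c] disj[of b c] mem dist by simp_all
  note disjoint = this
  show ?thesis
    by (rule exI[of _ C1], rule exI[of _ C2], rule exI[of _ C3])
      (simp only: C disjoint all_arcs simp_thms)
qed

section \<open>Odd modulus\<close>

text \<open>In the coordinates \<open>((s, x + y), y)\<close> the map is a skew product over a skew product.\<close>

lemma cyclic_on_layered:
  fixes m :: int
  assumes m: "m > 0"
    and D: "\<And>s w. D s w \<in> {e1, e2, e3}"
    and Z: "\<And>s w. D s w = e3 \<longleftrightarrow> Z s"
    and coprime: "coprime (\<Sum>s\<in>{0..<m}. if Z s then 0 else 1) m"
      "coprime (\<Sum>s\<in>{0..<m}. \<Sum>w\<in>{0..<m}. if D s w = e2 then 1 else 0) m"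
  shows "cyclic_on (\<lambda>v. add3 m v (case v of (x, y, z) \<Rightarrow> D ((x + y + z) mod m) ((x + y) mod m))) (Zm3 m)"
    (is "cyclic_on ?f _")
proof -
  \<comment> \<open>Every arc raises \<open>s\<close> by one; \<open>w = x + y\<close> grows unless
    the direction is \<open>e3\<close>, and \<open>y\<close> grows exactly for \<open>e2\<close>. By
    \<open>Z\<close> the growth of \<open>w\<close> depends on \<open>s\<close> alone, so the pair
    \<open>(s, w)\<close> moves independently of \<open>y\<close>.\<close>
  let ?r = "\<lambda>s. (s + 1) mod m" and ?\<alpha> = "\<lambda>s. if Z s then 0 else 1 :: int"
    and ?\<beta> = "\<lambda>(s, w). if D s w = e2 then 1 else 0 :: int"
  let ?F = "skew m (skew m ?r ?\<alpha>) ?\<beta>"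
  have "cyclic_on (skew m ?r ?\<alpha>) ({0..<m} \<times> {0..<m})"
    using m coprime by (intro cyclic_on_skew cyclic_on_rotation) auto
  then have "cyclic_on ?F (({0..<m} \<times> {0..<m}) \<times> {0..<m})"
    by (rule cyclic_on_skew) (use m coprime in \<open>auto simp: sum.cartesian_product\<close>)
  moreover define h where "h = (\<lambda>((s, w), y). ((w - y) mod m, y, (s - w) mod m))"
  have "?f (h v) = h (?F v)" if "v \<in> ({0..<m} \<times> {0..<m}) \<times> {0..<m}" for v
  proof -
    obtain s w y where v: "v = ((s, w), y)" by (metis surj_pair)
    have "((w - y) mod m + (y + (s - w) mod m)) mod m = (w - y + (y + (s - w) mod m)) mod m"
      by (rule mod_add_left_eq)
    also have "\<dots> = s" using that v by (simp add: mod_simps)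
    finally have "((w - y) mod m + y + (s - w) mod m) mod m = s" by (simp only: add.assoc)
    moreover have "((w - y) mod m + y) mod m = w"
      using that v by (simp add: mod_simps)
    ultimately have "?f (h v) = add3 m (h v) (D s w)" by (simp add: v h_def)
    also have "\<dots> = h (?F v)"
      using D[of s w] Z[of s w] that
      by (auto simp: v h_def skew_def e1_def e2_def e3_def mod_simps algebra_simps)
    finally show ?thesis .
  qed
  ultimately have "cyclic_on ?f (h ` (({0..<m} \<times> {0..<m}) \<times> {0..<m}))"
    by (rule cyclic_on_image)
  also have "h ` (({0..<m} \<times> {0..<m}) \<times> {0..<m}) = Zm3 m"
  proof (intro equalityI subsetI)
    fix v assume "v \<in> Zm3 m"
    then obtain x y z where v: "v = (x, y, z)" "x \<in> {0..<m}" "y \<in> {0..<m}" "z \<in> {0..<m}"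
      by (auto simp: Zm3_def)
    have "v = h (((x + y + z) mod m, (x + y) mod m), y)"
      using v by (simp add: h_def mod_simps)
    moreover have "(((x + y + z) mod m, (x + y) mod m), y) \<in> ({0..<m} \<times> {0..<m}) \<times> {0..<m}"
      using v m by simp
    ultimately show "v \<in> h ` (({0..<m} \<times> {0..<m}) \<times> {0..<m})" by (metis imageI)
  qed (use m in \<open>auto simp: h_def Zm3_def\<close>)
  finally show ?thesis .
qed

lemma sum_ends:
  fixes m :: int and g :: "int \<Rightarrow> int"
  assumes "m \<ge> 2" "\<And>s. 0 < s \<Longrightarrow> s < m - 1 \<Longrightarrow> g s = u"
  shows "(\<Sum>s\<in>{0..<m}. g s) = g 0 + g (m - 1) + (m - 2) * u"
proof -
  have "{0..<m} = insert 0 (insert (m - 1) {1..<m-1})" using assms(1) by auto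
  then have "(\<Sum>s\<in>{0..<m}. g s) = g 0 + g (m - 1) + (\<Sum>s\<in>{1..<m-1}. g s)" using assms(1) by simp
  also have "(\<Sum>s\<in>{1..<m-1}. g s) = (\<Sum>s\<in>{1..<m-1}. u)" using assms(2) by (intro sum.cong) auto
  finally show ?thesis using assms(1) by (simp add: algebra_simps)
qed

lemma sum_if_eq:
  fixes m p u v :: int
  assumes "0 \<le> p" "p < m"
  shows "(\<Sum>w\<in>{0..<m}. if w = p then u else v) = u + (m - 1) * v"
proof -
  have "(\<Sum>w\<in>{0..<m}. if w = p then u else v) = (\<Sum>w\<in>{0..<m}. v + (if w = p then u - v else 0))"
    by (intro sum.cong) auto
  also have "\<dots> = m * v + (u - v)" using assms by (simp add: sum.distrib)
  finally show ?thesis by (simp add: algebra_simps)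
qed

text \<open>In each layer one colour takes \<open>e3\<close> throughout: the second in layer
  \<open>0\<close>, the first in layer \<open>m - 1\<close>, the third elsewhere. So
  \<open>x + y\<close> grows \<open>m - 1\<close>, \<open>m - 1\<close> and \<open>2\<close> times
  per tour of the layers. The exceptional lines \<open>w = 0\<close> and \<open>w = 1\<close> make
  the numbers of choices of \<open>e2\<close> congruent to \<open>1\<close>, \<open>1\<close> and
  \<open>-2\<close> modulo \<open>m\<close>.\<close>

definition odd_dirs :: "int \<Rightarrow> int \<Rightarrow> int \<Rightarrow> int3 \<times> int3 \<times> int3" where
  "odd_dirs m s w =
    (if s = 0 then if w = 0 then (e2, e3, e1) else (e1, e3, e2)
     else if s = m - 1 then if w = 1 then (e3, e2, e1) else (e3, e1, e2)
     else (e1, e2, e3))"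

lemma odd_dirs_set: "{fst (odd_dirs m s w), fst (snd (odd_dirs m s w)), snd (snd (odd_dirs m s w))} = {e1, e2, e3}"
proof -
  have "odd_dirs m s w \<in> {(e1, e2, e3), (e1, e3, e2), (e2, e1, e3), (e2, e3, e1), (e3, e1, e2), (e3, e2, e1)}"
    by (simp add: odd_dirs_def)
  then show ?thesis by (elim insertE emptyE) (simp_all add: insert_commute)
qed

lemma cyclic_on_odd:
  fixes m :: int
  assumes m: "m \<ge> 3" "odd m" and D: "D \<in> {\<lambda>s w. fst (odd_dirs m s w), \<lambda>s w. fst (snd (odd_dirs m s w)),
      \<lambda>s w. snd (snd (odd_dirs m s w))}"
  shows "cyclic_on (\<lambda>v. add3 m v (case v of (x, y, z) \<Rightarrow> D ((x + y + z) mod m) ((x + y) mod m))) (Zm3 m)"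
proof -
  \<comment> \<open>Here \<open>u s\<close> is the value on the exceptional line
    \<open>w = p s\<close> of layer \<open>s\<close>, \<open>v s\<close> the value off it, and
    \<open>t\<close> the total of each middle layer.\<close>
  have count: "(\<Sum>s\<in>{0..<m}. \<Sum>w\<in>{0..<m}. if D s w = e2 then 1 else 0) =
      u 0 + (m - 1) * v 0 + (u (m - 1) + (m - 1) * v (m - 1)) + (m - 2) * t"
    if "\<And>s w. (if D s w = e2 then 1 else 0) = (if w = p s then u s else v s)"
      "\<And>s. p s = 0 \<or> p s = 1" "\<And>s. 0 < s \<Longrightarrow> s < m - 1 \<Longrightarrow> u s + (m - 1) * v s = t"
    for p u v :: "int \<Rightarrow> int" and t
  proof -
    have "0 \<le> p s" "p s < m" for s using that(2)[of s] m(1) by auto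
    then have "(\<Sum>w\<in>{0..<m}. if D s w = e2 then 1 else 0) = u s + (m - 1) * v s" for s
      unfolding that(1) by (rule sum_if_eq)
    then show ?thesis using sum_ends[OF _ that(3)] m(1) by simp
  qed
  consider "D = (\<lambda>s w. fst (odd_dirs m s w))" | "D = (\<lambda>s w. fst (snd (odd_dirs m s w)))"
    | "D = (\<lambda>s w. snd (snd (odd_dirs m s w)))" using D by blast
  then show ?thesis
  proof cases
    case 1
    have "(\<Sum>s\<in>{0..<m}. if s = m - 1 then 0 else 1) = 0 + (m - 1) * 1"
      using m by (intro sum_if_eq) auto
    moreover have "(\<Sum>s\<in>{0..<m}. \<Sum>w\<in>{0..<m}. if D s w = e2 then 1 else 0) = (1::int)"
      using m by (subst count[of "\<lambda>_. 0" "\<lambda>s. if s = 0 then 1 else 0" "\<lambda>_. 0" 0]) (auto simp: 1 odd_dirs_def)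
    ultimately show ?thesis
      using m by (intro cyclic_on_layered[where Z = "\<lambda>s. s = m - 1"]) (auto simp: 1 odd_dirs_def)
  next
    case 2
    have "(\<Sum>s\<in>{0..<m}. if s = 0 then 0 else 1) = 0 + (m - 1) * 1"
      using m by (intro sum_if_eq) auto
    moreover have "(\<Sum>s\<in>{0..<m}. \<Sum>w\<in>{0..<m}. if D s w = e2 then 1 else 0) = 1 + (m - 2) * m"
      using m by (subst count[of "\<lambda>_. 1" "\<lambda>s. if s = 0 then 0 else 1"
            "\<lambda>s. if s = 0 \<or> s = m - 1 then 0 else 1" m]) (auto simp: 2 odd_dirs_def)
    moreover have "coprime (1 + (m - 2) * m) m"
    proof (rule coprimeI)
      fix d assume "d dvd 1 + (m - 2) * m" "d dvd m"
      then show "d dvd 1" using dvd_add_left_iff[of d "(m - 2) * m" 1] by simp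
    qed
    ultimately show ?thesis
      using m by (intro cyclic_on_layered[where Z = "\<lambda>s. s = 0"]) (auto simp: 2 odd_dirs_def)
  next
    case 3
    have "(\<Sum>s\<in>{0..<m}. if s \<noteq> 0 \<and> s \<noteq> m - 1 then 0 else 1) = (2::int)"
      using m by (subst sum_ends[where u = 0]) auto
    moreover have "(\<Sum>s\<in>{0..<m}. \<Sum>w\<in>{0..<m}. if D s w = e2 then 1 else 0) = 2 * (m - 1)"
      using m by (subst count[of "\<lambda>s. if s = 0 then 0 else 1" "\<lambda>_. 0"
            "\<lambda>s. if s = 0 \<or> s = m - 1 then 1 else 0" 0]) (auto simp: 3 odd_dirs_def)
    \<comment> \<open>Oddness enters here: the two totals of the third colour are \<open>2\<close>
      and \<open>-2\<close> modulo \<open>m\<close>.\<close>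
    moreover have 2: "coprime 2 m" using m(2) by (simp add: coprime_left_2_iff_odd)
    moreover have "coprime (2 * m - 2) m"
    proof -
      have "coprime (2 * (m - 1)) m"
        using 2 by (simp only: coprime_mult_left_iff) simp
      then show ?thesis by (simp only: right_diff_distrib mult_1_right)
    qed
    ultimately show ?thesis
      using m by (intro cyclic_on_layered[where Z = "\<lambda>s. s \<noteq> 0 \<and> s \<noteq> m - 1"]) (auto simp: 3 odd_dirs_def)
  qed
qed

section \<open>Even modulus\<close>

text \<open>Within a layer \<open>z\<close> is determined by \<open>x\<close> and \<open>y\<close>,
  so plane coordinates suffice and \<open>e3\<close> fixes them.\<close>

definition move :: "int \<Rightarrow> int3 \<Rightarrow> int \<times> int \<Rightarrow> int \<times> int" where
  "move m e = (\<lambda>(x, y). if e = e1 then ((x + 1) mod m, y) else if e = e2 then (x, (y + 1) mod m) else (x, y))"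

text \<open>The \<open>m - 3\<close> middle layers use one constant direction; modulo \<open>m\<close> this is three steps back.\<close>

definition move_back3 :: "int \<Rightarrow> int3 \<Rightarrow> int \<times> int \<Rightarrow> int \<times> int" where
  "move_back3 m e = (\<lambda>(x, y). if e = e1 then ((x - 3) mod m, y) else if e = e2 then (x, (y - 3) mod m) else (x, y))"

lemma move_in: "m > 0 \<Longrightarrow> v \<in> {0..<m} \<times> {0..<m} \<Longrightarrow> move m e v \<in> {0..<m} \<times> {0..<m}"
  by (auto simp: move_def)

lemma move_funpow:
  assumes "x \<in> {0..<m}" "y \<in> {0..<m}"
  shows "(move m e ^^ k) (x, y) = (if e = e1 then ((x + int k) mod m, y)
    else if e = e2 then (x, (y + int k) mod m) else (x, y))"
  using assms by (induction k) (auto simp: move_def mod_simps ac_simps)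

definition layer_return :: "int \<Rightarrow> (int \<Rightarrow> int \<Rightarrow> int \<Rightarrow> int3) \<Rightarrow> int3 \<Rightarrow> int \<times> int \<Rightarrow> int \<times> int" where
  "layer_return m D e = (let go = \<lambda>s (x, y). move m (D s x y) (x, y) in
     go (m - 1) \<circ> move_back3 m e \<circ> go 1 \<circ> go 0)"

text \<open>The layers are the levels of a tower over layer \<open>0\<close>, which reduces the
  claim to a map of the plane.\<close>

lemma cyclic_on_if_return:
  fixes m :: int
  assumes m: "m \<ge> 3"
    and D: "\<And>s x y. D s x y \<in> {e1, e2, e3}"
    and mid: "\<And>s x y. 2 \<le> s \<Longrightarrow> s < m - 1 \<Longrightarrow> D s x y = e"
    and R: "cyclic_on (layer_return m D e) ({0..<m} \<times> {0..<m})"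
  shows "cyclic_on (\<lambda>v. add3 m v (case v of (x, y, z) \<Rightarrow> D ((x + y + z) mod m) x y)) (Zm3 m)"
    (is "cyclic_on ?f _")
proof -
  let ?Y = "{0..<m} \<times> {0..<m}" and ?n = "nat m"
  define go where "go s = (\<lambda>(x, y). move m (D s x y) (x, y))" for s
  define F where "F = (\<lambda>(v, s). (go (int s) v, Suc s mod ?n))"
  have go_in: "go s v \<in> ?Y" if "v \<in> ?Y" for s v
    using move_in[OF _ that] m by (cases v) (simp add: go_def)
  have "cyclic_on F (?Y \<times> {0..<?n})"
  proof (rule cyclic_on_tower[OF R])
    show "?n > 0" using m by simp
    show "fst (F (v, s)) \<in> ?Y \<and> snd (F (v, s)) = Suc s mod ?n" if "v \<in> ?Y" for v s
      using go_in[OF that] by (simp add: F_def)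
    fix v assume v: "v \<in> ?Y"
    have ascend: "(F ^^ k) (w, 2) = ((move m e ^^ k) w, 2 + k)" if "w \<in> ?Y" "k + 2 < ?n" for w k
      using that
    proof (induction k)
      case (Suc k)
      then have "go (int (2 + k)) = move m e" using mid by (auto simp: go_def)
      then show ?case using Suc by (simp add: F_def)
    qed simp
    \<comment> \<open>The tour splits into two steps, then \<open>m - 3\<close> steps in the
      constant direction from level \<open>2\<close> to level \<open>m - 1\<close>, then one last
      step.\<close>
    have "?n = Suc ((?n - 3) + 2)" using m by simp
    then have "(F ^^ ?n) (v, 0) = F ((F ^^ (?n - 3)) ((F ^^ 2) (v, 0)))"
      by (metis comp_apply funpow_add funpow.simps(2))
    also have "(F ^^ 2) (v, 0) = (go 1 (go 0 v), 2)"
      using m by (simp add: F_def numeral_2_eq_2)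
    also have "(F ^^ (?n - 3)) \<dots> = ((move m e ^^ (?n - 3)) (go 1 (go 0 v)), 2 + (?n - 3))"
      using m by (intro ascend go_in v) auto
    also have "(move m e ^^ (?n - 3)) (go 1 (go 0 v)) = move_back3 m e (go 1 (go 0 v))"
    proof -
      have "(x + (m - 3)) mod m = (x - 3) mod m" for x
        using mod_add_self2[of "x - 3" m] by (simp add: algebra_simps)
      moreover obtain x y where "go 1 (go 0 v) = (x, y)" "x \<in> {0..<m}" "y \<in> {0..<m}"
        using go_in[OF go_in[OF v]] by (metis SigmaE)
      ultimately show ?thesis using m by (simp add: move_funpow move_back3_def of_nat_diff)
    qed
    also have "F (\<dots>, 2 + (?n - 3)) = (layer_return m D e v, 0)"
    proof -
      have "int (2 + (?n - 3)) = m - 1" "Suc (2 + (?n - 3)) = ?n" using m by auto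
      then show ?thesis by (simp add: F_def layer_return_def go_def Let_def)
    qed
    finally show "(F ^^ ?n) (v, 0) = (layer_return m D e v, 0)" .
  qed
  moreover define h where "h = (\<lambda>((x, y), s). (x, y, (int s - (x + y)) mod m))"
  have "?f (h v) = h (F v)" if "v \<in> ?Y \<times> {0..<?n}" for v
  proof -
    obtain x y s where v: "v = ((x, y), s)" by (metis surj_pair)
    have "int s < m" using that v by (simp add: zless_nat_eq_int_zless)
    then have "(x + y + (int s - (x + y)) mod m) mod m = int s" by (simp add: mod_simps)
    then have "?f (h v) = add3 m (h v) (D (int s) x y)" by (simp add: v h_def)
    moreover have "(c - (d + b mod m)) mod m = (c - (d + b)) mod m" for b c d
      by (metis mod_add_right_eq mod_diff_right_eq)
    ultimately show "?f (h v) = h (F v)"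
      using D[of "int s" x y] that v m
      by (auto simp: h_def F_def go_def move_def e1_def e2_def e3_def zmod_int mod_simps algebra_simps)
  qed
  ultimately have "cyclic_on ?f (h ` (?Y \<times> {0..<?n}))"
    by (rule cyclic_on_image)
  also have "h ` (?Y \<times> {0..<?n}) = Zm3 m"
  proof (intro equalityI subsetI)
    fix v assume "v \<in> Zm3 m"
    then obtain x y z where v: "v = (x, y, z)" "x \<in> {0..<m}" "y \<in> {0..<m}" "z \<in> {0..<m}"
      by (auto simp: Zm3_def)
    have "v = h ((x, y), nat ((x + y + z) mod m))"
      using v m by (simp add: h_def mod_simps)
    moreover have "((x, y), nat ((x + y + z) mod m)) \<in> ?Y \<times> {0..<?n}"
      using v m by (simp add: nat_less_iff)
    ultimately show "v \<in> h ` (?Y \<times> {0..<?n})" by (metis imageI)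
  qed (use m in \<open>auto simp: h_def Zm3_def\<close>)
  finally show ?thesis .
qed

text \<open>
  Layer \<open>0\<close> carries the three lines with the defect around the origin; its shape was found by
  computer search. The single lines in layers \<open>1\<close> and \<open>m - 1\<close> adjust the three drifts.
\<close>

definition even_dirs :: "int \<Rightarrow> int \<Rightarrow> int \<Rightarrow> int \<Rightarrow> int3 \<times> int3 \<times> int3" where
  "even_dirs m s x y =
    (if s = 0 then
       if x = 0 \<and> y = 0 \<or> x = m - 1 \<and> y = m - 1 then (e2, e1, e3)
       else if x = m - 1 \<and> y = 1 then (e2, e3, e1)
       else if x = 1 \<and> y = m - 1 then (e3, e1, e2)
       else if x = m - 1 \<and> y = 0 then (e1, e3, e2)
       else if x = 0 \<and> y = m - 1 then (e3, e2, e1)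
       else if x = 0 then (e1, e3, e2)
       else if y = 0 then (e3, e2, e1)
       else if x + y = m then (e2, e1, e3)
       else (e1, e2, e3)
     else if s = 1 then if (x + y) mod m = 1 then (e3, e2, e1) else (e3, e1, e2)
     else if s = m - 1 \<and> x = 1 then (e1, e3, e2)
     else (e1, e2, e3))"

text \<open>
  The return maps to layer \<open>0\<close> of the three colours. Away from a few lines they drift by
  \<open>(-1, 0)\<close>, \<open>(1, -1)\<close> and \<open>(0, 1)\<close>.
\<close>

definition return_a :: "int \<Rightarrow> int \<times> int \<Rightarrow> int \<times> int" where
  "return_a m = (\<lambda>(x, y).
     if y = 0 then if x = 0 then (m - 2, 1) else if x = m - 1 then (m - 2, 0) else ((x - 2) mod m, 0)
     else if y = m - 1 then
       if x = m - 1 then (m - 3, 0) else if x \<le> 1 then ((x - 2) mod m, y) else (x - 1, y)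
     else if x + y = m then (x - 2, y + 1) else ((x - 1) mod m, y))"

definition return_b :: "int \<Rightarrow> int \<times> int \<Rightarrow> int \<times> int" where
  "return_b m = (\<lambda>(x, y).
     if x = 0 then
       if y = 0 then (1, m - 2) else if y = 1 then (0, 0) else if y = m - 1 then (1, m - 3)
       else (1, (y - 3) mod m)
     else if x = m - 1 then
       if y = 0 then (0, m - 2) else if y = 1 then (0, m - 1) else if y = m - 1 then (1, m - 4)
       else (0, y - 1)
     else (x + 1, (y - 1) mod m))"

definition return_c :: "int \<Rightarrow> int \<times> int \<Rightarrow> int \<times> int" where
  "return_c m = (\<lambda>(x, y).
     if x = 0 then if y = 0 then (0, 1) else if y = m - 1 then (1, 1) else (0, (y + 2) mod m)
     else if x = 1 then if y = 0 then (2, 1) else if y = m - 1 then (2, 0) else (1, (y + 2) mod m)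
     else if y = 0 then if x = m - 1 then (m - 1, 2) else (x + 1, 1)
     else if x + y = m + 1 then ((x + 1) mod m, y)
     else if x = m - 1 \<and> y = 1 then (1, 2) else (x, (y + 1) mod m))"

section \<open>Computation of the three return maps\<close>

lemma even_dirs_set: "{fst (even_dirs m s x y), fst (snd (even_dirs m s x y)), snd (snd (even_dirs m s x y))} = {e1, e2, e3}"
proof -
  have "even_dirs m s x y \<in> {(e1, e2, e3), (e1, e3, e2), (e2, e1, e3), (e2, e3, e1), (e3, e1, e2), (e3, e2, e1)}"
    by (simp add: even_dirs_def)
  then show ?thesis by (elim insertE emptyE) (simp_all add: insert_commute)
qed

text \<open>Each shift wraps around at most once, so \<open>mod\<close> becomes a case distinction
  with linear branches.\<close>

lemma mod_shift:
  fixes m x y :: int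
  assumes "0 \<le> x" "x < m"
  shows "(x + 1) mod m = (if x = m - 1 then 0 else x + 1)"
    "2 \<le> m \<Longrightarrow> (x + 2) mod m = (if x \<ge> m - 2 then x + 2 - m else x + 2)"
    "(x - 1) mod m = (if x = 0 then m - 1 else x - 1)"
    "2 \<le> m \<Longrightarrow> (x - 2) mod m = (if x < 2 then x + m - 2 else x - 2)"
    "3 \<le> m \<Longrightarrow> (x - 3) mod m = (if x < 3 then x + m - 3 else x - 3)"
    "0 \<le> y \<Longrightarrow> y < m \<Longrightarrow> (x + y) mod m = (if x + y < m then x + y else x + y - m)"
proof -
  have shift: "t mod m = t + m" if "- m \<le> t" "t < 0" for t
    using that mod_pos_pos_trivial[of "t + m" m] by simp
  have unshift: "t mod m = t - m" if "m \<le> t" "t < 2 * m" for t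
    using that mod_pos_pos_trivial[of "t - m" m] minus_mod_self2[of t m] by simp
  show "(x + 1) mod m = (if x = m - 1 then 0 else x + 1)" using assms by simp
  show "2 \<le> m \<Longrightarrow> (x + 2) mod m = (if x \<ge> m - 2 then x + 2 - m else x + 2)"
    using assms unshift[of "x + 2"] by auto
  show "(x - 1) mod m = (if x = 0 then m - 1 else x - 1)"
    using assms shift[of "x - 1"] by auto
  show "2 \<le> m \<Longrightarrow> (x - 2) mod m = (if x < 2 then x + m - 2 else x - 2)"
    using assms shift[of "x - 2"] by auto
  show "3 \<le> m \<Longrightarrow> (x - 3) mod m = (if x < 3 then x + m - 3 else x - 3)"
    using assms shift[of "x - 3"] by auto
  show "0 \<le> y \<Longrightarrow> y < m \<Longrightarrow> (x + y) mod m = (if x + y < m then x + y else x + y - m)"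
    using assms unshift[of "x + y"] by auto
qed

lemma minus_mod:
  assumes "(m::int) \<ge> 4"
  shows "- 1 mod m = m - 1" "- 2 mod m = m - 2" "- 3 mod m = m - 3" "- 4 mod m = m - 4"
    "(2 * m - 2) mod m = m - 2"
proof -
  show "- 1 mod m = m - 1" "- 2 mod m = m - 2" "- 3 mod m = m - 3"
    using mod_shift(3,4,5)[of 0 m] assms by simp_all
  show "- 4 mod m = m - 4"
    using assms minus_mod_int_eq[of m 4] by (cases "m = 4") simp_all
  show "(2 * m - 2) mod m = m - 2"
    using mod_shift(6)[of "m - 1" m "m - 1"] assms by simp
qed

lemma even_dirs_rest:
  assumes "m \<ge> 4"
  shows "even_dirs m 1 x y = (if (x + y) mod m = 1 then (e3, e2, e1) else (e3, e1, e2))"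
    "even_dirs m (m - 1) x y = (if x = 1 then (e1, e3, e2) else (e1, e2, e3))"
  using assms by (simp_all add: even_dirs_def)

text \<open>For this colour layer \<open>1\<close> fixes the plane and layer \<open>m - 1\<close>
  always steps in \<open>x\<close>; with the three steps back this is a uniform shift by
  \<open>-2\<close>, so all irregularities come from layer \<open>0\<close>.\<close>

lemma layer_return_a:
  assumes "m \<ge> 4" "x \<in> {0..<m}" "y \<in> {0..<m}"
  shows "layer_return m (\<lambda>s x y. fst (even_dirs m s x y)) e1 (x, y) = return_a m (x, y)"
proof -
  have "move m (fst (even_dirs m (m - 1) x' y')) (x', y') = ((x' + 1) mod m, y')"
    "move m (fst (even_dirs m 1 x' y')) (x', y') = (x', y')" for x' y'
    using assms(1) by (simp_all add: even_dirs_rest move_def)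
  then have "layer_return m (\<lambda>s x y. fst (even_dirs m s x y)) e1 (x, y) =
      (\<lambda>(x, y). ((x - 2) mod m, y)) (move m (fst (even_dirs m 0 x y)) (x, y))"
    by (simp add: layer_return_def Let_def move_back3_def split_beta mod_simps)
  also have "\<dots> = return_a m (x, y)"
    using assms by (auto simp: even_dirs_def move_def return_a_def mod_shift minus_mod)
  finally show ?thesis .
qed

lemma layer_return_b:
  assumes "m \<ge> 4" "x \<in> {0..<m}" "y \<in> {0..<m}"
  shows "layer_return m (\<lambda>s x y. fst (snd (even_dirs m s x y))) e2 (x, y) = return_b m (x, y)"
proof -
  \<comment> \<open>\<open>H\<close> is the passage from layer \<open>1\<close> back to layer
    \<open>0\<close>. The line \<open>x = 1\<close> of layer \<open>m - 1\<close> shows up at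
    \<open>x = 0\<close> for points that layer \<open>1\<close> moves in \<open>x\<close>.\<close>
  define H where "H = (\<lambda>(x, y). if (x + y) mod m = 1 then (x, (y - (if x = 1 then 2 else 1)) mod m)
     else ((x + 1) mod m, (y - (if x = 0 then 3 else 2)) mod m))"
  let ?D = "\<lambda>s x y. fst (snd (even_dirs m s x y))"
  have rest: "(\<lambda>(x, y). move m (?D (m - 1) x y) (x, y)) (move_back3 m e2 (move m (?D 1 x' y') (x', y'))) = H (x', y')"
    if "x' \<in> {0..<m}" for x' y'
    using assms(1) that mod_shift(1)[of x' m]
    by (auto simp: even_dirs_rest move_def move_back3_def H_def mod_simps add.commute[of 2])
  obtain x' y' where v: "move m (?D 0 x y) (x, y) = (x', y')" by (metis surj_pair)
  moreover have "fst (move m e (x, y)) \<in> {0..<m}" for e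
    using assms by (simp add: move_def)
  ultimately have "x' \<in> {0..<m}" by (metis fst_conv)
  from rest[OF this] have "layer_return m ?D e2 (x, y) = H (move m (?D 0 x y) (x, y))"
    by (simp only: layer_return_def Let_def comp_apply split v)
  also have "\<dots> = return_b m (x, y)"
  proof -
    consider "x = 0" | "x = m - 1" | "x \<noteq> 0" "x \<noteq> m - 1" "y = 0" | "x \<noteq> 0" "x \<noteq> m - 1" "y = m - 1"
      | "x \<noteq> 0" "x \<noteq> m - 1" "y \<noteq> 0" "y \<noteq> m - 1" by blast
    then show ?thesis
      using assms by cases (simp_all add: even_dirs_def move_def return_b_def H_def mod_shift minus_mod)
  qed
  finally show ?thesis .
qed

lemma layer_return_c:
  assumes "m \<ge> 4" "x \<in> {0..<m}" "y \<in> {0..<m}"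
  shows "layer_return m (\<lambda>s x y. snd (snd (even_dirs m s x y))) e3 (x, y) = return_c m (x, y)"
proof -
  \<comment> \<open>As for the second colour, but the middle layers now fix the plane and layer
    \<open>1\<close> moves the line \<open>x + y = 1\<close> in \<open>x\<close>.\<close>
  define H where "H = (\<lambda>(x, y). if (x + y) mod m = 1 then ((x + 1) mod m, if x = 0 then (y + 1) mod m else y)
     else (x, (y + (if x = 1 then 2 else 1)) mod m))"
  let ?D = "\<lambda>s x y. snd (snd (even_dirs m s x y))"
  have rest: "(\<lambda>(x, y). move m (?D (m - 1) x y) (x, y)) (move_back3 m e3 (move m (?D 1 x' y') (x', y'))) = H (x', y')"
    if "x' \<in> {0..<m}" for x' y'
    using assms(1) that mod_shift(1)[of x' m]
    by (auto simp: even_dirs_rest move_def move_back3_def H_def mod_simps add.commute[of 2])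
  obtain x' y' where v: "move m (?D 0 x y) (x, y) = (x', y')" by (metis surj_pair)
  moreover have "fst (move m e (x, y)) \<in> {0..<m}" for e
    using assms by (simp add: move_def)
  ultimately have "x' \<in> {0..<m}" by (metis fst_conv)
  from rest[OF this] have "layer_return m ?D e3 (x, y) = H (move m (?D 0 x y) (x, y))"
    by (simp only: layer_return_def Let_def comp_apply split v)
  also have "\<dots> = return_c m (x, y)"
  proof -
    consider "x = 0" | "x = m - 1" | "x \<noteq> 0" "x \<noteq> m - 1" "y = 0" | "x \<noteq> 0" "x \<noteq> m - 1" "y = m - 1"
      | "x \<noteq> 0" "x \<noteq> m - 1" "y \<noteq> 0" "y \<noteq> m - 1" by blast
    then show ?thesis
      using assms by cases (simp_all add: even_dirs_def move_def return_c_def H_def mod_shift minus_mod)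
  qed
  finally show ?thesis .
qed

section \<open>Tracing the return maps along arithmetic progressions\<close>

lemma up_induct:
  fixes x a b d :: int
  assumes base: "P a" and step: "\<And>y. a \<le> y \<Longrightarrow> y + d \<le> b \<Longrightarrow> P y \<Longrightarrow> P (y + d)"
    and x: "a \<le> x" "x \<le> b" "d dvd x - a" and d: "d > 0"
  shows "P x"
proof -
  obtain q where q: "x - a = d * q" using x(3) by (auto simp: dvd_def)
  then have "q \<ge> 0" using x(1) d by (smt (verit) mult_pos_neg)
  then have k: "x = a + d * int (nat q)" using q by (simp add: algebra_simps)
  have "P (a + d * int j)" if "a + d * int j \<le> b" for j
    using that
  proof (induction j)
    case (Suc j)
    have "a + d * int (Suc j) = (a + d * int j) + d" by (simp add: algebra_simps)
    moreover have "0 \<le> d * int j" using d by simp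
    ultimately show ?case using step[of "a + d * int j"] Suc d by (simp only:)
  qed (use base in simp)
  then show ?thesis using k x(2) by metis
qed

lemma down_induct:
  fixes x a b d :: int
  assumes base: "P a" and step: "\<And>y. y \<le> a \<Longrightarrow> b \<le> y - d \<Longrightarrow> P y \<Longrightarrow> P (y - d)"
    and x: "b \<le> x" "x \<le> a" "d dvd a - x" and d: "d > 0"
  shows "P x"
proof -
  have "P (- (- x))"
  proof (rule up_induct[of "\<lambda>y. P (- y)" "-a" d "-b"])
    fix y assume "- a \<le> y" "y + d \<le> - b" "P (- y)"
    then have "P (- y - d)" using step[of "-y"] by simp
    then show "P (- (y + d))" by simp
  qed (use assms in simp_all)
  then show ?thesis by simp
qed

lemma return_a_values:
  assumes "(m::int) \<ge> 4" "x \<in> {0..<m}" "y \<in> {0..<m}"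
  shows "return_a m (0, 0) = (m - 2, 1)"
    "return_a m (1, 0) = (m - 1, 0)"
    "2 \<le> x \<Longrightarrow> x < m - 1 \<Longrightarrow> return_a m (x, 0) = (x - 2, 0)"
    "return_a m (m - 1, m - 1) = (m - 3, 0)"
    "return_a m (0, m - 1) = (m - 2, m - 1)"
    "return_a m (1, m - 1) = (m - 1, m - 1)"
    "2 \<le> x \<Longrightarrow> x < m - 1 \<Longrightarrow> return_a m (x, m - 1) = (x - 1, m - 1)"
    "1 \<le> y \<Longrightarrow> y < m - 1 \<Longrightarrow> return_a m (0, y) = (m - 1, y)"
    "1 \<le> y \<Longrightarrow> y < m - 1 \<Longrightarrow> return_a m (m - y, y) = (m - y - 2, y + 1)"
    "1 \<le> y \<Longrightarrow> y < m - 1 \<Longrightarrow> 0 < x \<Longrightarrow> x + y \<noteq> m \<Longrightarrow> return_a m (x, y) = (x - 1, y)"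
  using assms
  by (auto simp: return_a_def minus_mod_int_eq zmod_minus1)

text \<open>
  For \<open>0 < y < m - 1\<close>, row \<open>y\<close> is entered at \<open>(m - 1 - y, y)\<close> and traversed leftwards up to the exit
  \<open>(m - y, y)\<close>. In row \<open>0\<close> the drift is \<open>-2\<close>: the odd columns come first, and \<open>(m - 1, 0)\<close>
  switches to the even ones.
\<close>

lemma cyclic_on_return_a:
  fixes m :: int
  assumes m: "m \<ge> 4" "even m"
  shows "cyclic_on (return_a m) ({0..<m} \<times> {0..<m})"
proof (rule cyclic_on_if_covered[of "(0, 0)"])
  note R = return_a_values[OF m(1)]
  show "(0, 0) \<in> {0..<m} \<times> {0..<m}" using m by simp
  show "return_a m v \<in> {0..<m} \<times> {0..<m}" if "v \<in> {0..<m} \<times> {0..<m}" for v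
    using that m by (auto simp: return_a_def)
  fix A assume start: "return_a m (0, 0) \<in> A"
    and closed': "\<And>v. v \<in> {0..<m} \<times> {0..<m} \<Longrightarrow> v \<in> A \<Longrightarrow> return_a m v \<in> A"
  have closed: "return_a m (x, y) \<in> A" if "(x, y) \<in> A" "0 \<le> x" "x < m" "0 \<le> y" "y < m" for x y
    using closed' that by simp
  have row: "(\<forall>x\<in>{0..<m}. (x, y) \<in> A) \<and> (m - 2 - y, y + 1) \<in> A"
    if y: "1 \<le> y" "y < m - 1" and entry: "(m - 1 - y, y) \<in> A" for y
  proof -
    have step: "(x - 1, y) \<in> A" if "(x, y) \<in> A" "0 < x" "x < m" "x + y \<noteq> m" for x
      using closed[OF that(1)] R(10)[of x y] that y by simp
    have left: "(x, y) \<in> A" if "0 \<le> x" "x \<le> m - 1 - y" for x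
      by (rule down_induct[where P = "\<lambda>x. (x, y) \<in> A" and a = "m - 1 - y" and b = 0 and d = 1])
        (use that entry step y in simp_all)
    \<comment> \<open>Column \<open>0\<close> continues at column \<open>m - 1\<close>; the rest of
      the row is traversed from there to its exit.\<close>
    have "(m - 1, y) \<in> A" using closed[OF left[of 0]] R(8)[of 0 y] y by simp
    then have right: "(x, y) \<in> A" if "m - y \<le> x" "x \<le> m - 1" for x
      by (rule down_induct[where P = "\<lambda>x. (x, y) \<in> A" and a = "m - 1" and b = "m - y" and d = 1])
        (use \<open>(m - 1, y) \<in> A\<close> that step y in simp_all)
    have "(m - y - 2, y + 1) \<in> A" using closed[OF right[of "m - y"]] R(9)[of 0 y] y by simp
    then have "(m - 2 - y, y + 1) \<in> A" by (simp add: algebra_simps)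
    moreover have "(x, y) \<in> A" if "x \<in> {0..<m}" for x
      using left[of x] right[of x] that by fastforce
    ultimately show ?thesis by blast
  qed
  have entry: "(m - 1 - y, y) \<in> A" if "1 \<le> y" "y \<le> m - 1" for y
  proof (rule up_induct[where P = "\<lambda>y. (m - 1 - y, y) \<in> A" and a = 1 and b = "m - 1" and d = 1])
    fix y assume "1 \<le> y" "y + 1 \<le> m - 1" "(m - 1 - y, y) \<in> A"
    then show "(m - 1 - (y + 1), y + 1) \<in> A" using row[of y] by (simp add: algebra_simps)
  qed (use that start R(1)[of 0 0] m in simp_all)
  have 0: "(0, m - 1) \<in> A" using entry[of "m - 1"] m by simp
  \<comment> \<open>In the top row, entered at column \<open>0\<close>, the cell in column
    \<open>m - 1\<close> comes last and leads to the odd columns of row \<open>0\<close>.\<close>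
  have top: "(x, m - 1) \<in> A" if "1 \<le> x" "x \<le> m - 2" for x
  proof (rule down_induct[where P = "\<lambda>x. (x, m - 1) \<in> A" and a = "m - 2" and b = 1 and d = 1])
    show "(m - 2, m - 1) \<in> A" using closed[OF 0] R(5)[of 0 0] m by simp
    fix x assume "x \<le> m - 2" "1 \<le> x - 1" "(x, m - 1) \<in> A"
    then show "(x - 1, m - 1) \<in> A" using closed[of x "m - 1"] R(7)[of x 0] m by simp
  qed (use that in simp_all)
  have corner: "(m - 1, m - 1) \<in> A" using closed[OF top[of 1]] R(6)[of 0 0] m by simp
  have step: "(x - 2, 0) \<in> A" if "(x, 0) \<in> A" "2 \<le> x" "x < m - 1" for x
    using closed[OF that(1)] R(3)[of x 0] that m by simp
  have bottom_odd: "(x, 0) \<in> A" if "1 \<le> x" "x \<le> m - 3" "odd x" for x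
  proof (rule down_induct[where P = "\<lambda>x. (x, 0) \<in> A" and a = "m - 3" and b = 1 and d = 2])
    show "(m - 3, 0) \<in> A" using closed[OF corner] R(4)[of 0 0] m by simp
  qed (use that step m in simp_all)
  have last: "(m - 1, 0) \<in> A" using closed[OF bottom_odd[of 1]] R(2)[of 0 0] m by simp
  have bottom_even: "(x, 0) \<in> A" if "0 \<le> x" "x \<le> m - 2" "even x" for x
  proof (rule down_induct[where P = "\<lambda>x. (x, 0) \<in> A" and a = "m - 2" and b = 0 and d = 2])
    show "(m - 2, 0) \<in> A" using closed[OF last] m by (simp add: return_a_def)
  qed (use that step m in simp_all)
  show "{0..<m} \<times> {0..<m} \<subseteq> A"
  proof clarify
    fix x y assume xy: "x \<in> {0..<m}" "y \<in> {0..<m}"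
    \<comment> \<open>As \<open>m\<close> is even, the two parity ranges in row \<open>0\<close>
      miss only the cell \<open>(m - 1, 0)\<close>.\<close>
    have parity: "x \<noteq> m - 1" if "even x" using that m(2) by auto
    have parity': "x \<noteq> m - 2" if "odd x" using that m(2) by auto
    consider "1 \<le> y" "y < m - 1" | "y = m - 1" | "y = 0" "even x" | "y = 0" "odd x"
      using xy by fastforce
    then show "(x, y) \<in> A"
    proof cases
      case 1 then show ?thesis using row[OF 1 entry] xy by simp
    next
      case 2
      show ?thesis using 0 corner top[of x] xy 2
        by (cases "x = 0"; cases "x = m - 1") simp_all
    next
      case 3
      then show ?thesis using bottom_even[of x] parity xy by simp
    next
      case 4
      then have "x \<noteq> 0" by auto
      then show ?thesis using bottom_odd[of x] parity' last xy 4 by (cases "x = m - 1") simp_all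
    qed
  qed
qed

text \<open>
  Following an antidiagonal once around leads from \<open>(1, y)\<close> to \<open>(1, y - 2)\<close>; the exceptional cells in
  columns \<open>0\<close> and \<open>m - 1\<close> join the odd and the even values of \<open>y\<close>.
\<close>

lemma cyclic_on_return_b:
  fixes m :: int
  assumes m: "m \<ge> 4" "even m"
  shows "cyclic_on (return_b m) ({0..<m} \<times> {0..<m})"
proof (rule cyclic_on_if_covered[of "(0, 2)"])
  show "(0, 2) \<in> {0..<m} \<times> {0..<m}" using m by simp
  show "return_b m v \<in> {0..<m} \<times> {0..<m}" if "v \<in> {0..<m} \<times> {0..<m}" for v
    using that m by (auto simp: return_b_def)
  fix A assume start: "return_b m (0, 2) \<in> A"
    and closed': "\<And>v. v \<in> {0..<m} \<times> {0..<m} \<Longrightarrow> v \<in> A \<Longrightarrow> return_b m v \<in> A"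
  have closed: "return_b m (x, y) \<in> A" if "(x, y) \<in> A" "0 \<le> x" "x < m" "0 \<le> y" "y < m" for x y
    using closed' that by simp
  have antidiagonal: "(x, (y - x + 1) mod m) \<in> A"
    if "(1, y) \<in> A" "0 \<le> y" "y < m" and x: "1 \<le> x" "x \<le> m - 1" for x y
  proof (rule up_induct[of "\<lambda>x. (x, (y - x + 1) mod m) \<in> A" 1 1 "m - 1"])
    fix x assume "1 \<le> x" "x + 1 \<le> m - 1" "(x, (y - x + 1) mod m) \<in> A"
    then show "(x + 1, (y - (x + 1) + 1) mod m) \<in> A"
      using closed[of x "(y - x + 1) mod m"] m by (simp add: return_b_def mod_simps)
  qed (use that in simp_all)
  have last: "(m - 1, (y + 2) mod m) \<in> A" if "(1, y) \<in> A" "0 \<le> y" "y < m" for y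
    using antidiagonal[OF that, of "m - 1"] m mod_add_self2[of "y - m + 2" m] by (simp add: algebra_simps)
  have generic: "(0, y + 1) \<in> A \<and> (1, (y - 2) mod m) \<in> A" if "(1, y) \<in> A" "1 \<le> y" "y \<le> m - 4" for y
  proof -
    have "(m - 1, y + 2) \<in> A" using last[of y] that by simp
    then have "(0, y + 1) \<in> A"
      using closed[of "m - 1" "y + 2"] that m by (simp add: return_b_def add.commute)
    then show ?thesis
      using closed[of 0 "y + 1"] that by (simp add: return_b_def)
  qed
  \<comment> \<open>Column \<open>1\<close> is met in the rows \<open>m - 1\<close>,
    \<open>m - 3\<close>, then the even rows from \<open>m - 4\<close> to \<open>0\<close>, then
    \<open>m - 2\<close>, then the odd rows from \<open>m - 5\<close> to \<open>1\<close>; the last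
    segment is empty for \<open>m = 4\<close>.\<close>
  have 1: "(1, m - 1) \<in> A" using start m by (simp add: return_b_def minus_mod)
  have "(m - 1, 1) \<in> A" using last[OF 1] m mod_add_self2[of 1 m] by (simp add: algebra_simps)
  then have 2: "(0, m - 1) \<in> A" using closed[of "m - 1" 1] m by (simp add: return_b_def)
  then have 3: "(1, m - 3) \<in> A" using closed[of 0 "m - 1"] m by (simp add: return_b_def)
  \<comment> \<open>The cell \<open>(m - 1, m - 1)\<close> skips column \<open>0\<close>, which
    changes the parity of the row met in column \<open>1\<close>.\<close>
  have "(m - 1, m - 1) \<in> A" using last[OF 3] m by (simp add: minus_mod)
  then have 4: "(1, m - 4) \<in> A" using closed[of "m - 1" "m - 1"] m by (simp add: return_b_def)
  have evens: "(1, y) \<in> A" if "0 \<le> y" "y \<le> m - 4" "even y" for y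
  proof (rule down_induct[of "\<lambda>y. (1, y) \<in> A" "m - 4" 0 2])
    fix y assume "y \<le> m - 4" "0 \<le> y - 2" "(1, y) \<in> A"
    then show "(1, y - 2) \<in> A" using generic[of y] by simp
  qed (use that 4 m in simp_all)
  have "(m - 1, 2) \<in> A" using last[OF evens[of 0]] m by simp
  then have 5: "(0, 1) \<in> A" using closed[of "m - 1" 2] m by (simp add: return_b_def)
  then have 6: "(0, 0) \<in> A" using closed[of 0 1] m by (simp add: return_b_def)
  then have 7: "(1, m - 2) \<in> A" using closed[of 0 0] m by (simp add: return_b_def)
  \<comment> \<open>The cell \<open>(m - 1, 0)\<close> leads one row lower than the drift would,
    which changes the parity back.\<close>
  have "(m - 1, 0) \<in> A" using last[OF 7] m by simp
  then have 8: "(0, m - 2) \<in> A" using closed[of "m - 1" 0] m by (simp add: return_b_def)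
  have odds: "(1, y) \<in> A" if "1 \<le> y" "y \<le> m - 5" "odd y" for y
  proof (rule down_induct[of "\<lambda>y. (1, y) \<in> A" "m - 5" 1 2])
    have "(m - 2 - 3) mod m = m - 5" using that by (intro mod_pos_pos_trivial[THEN trans]) auto
    then show "(1, m - 5) \<in> A" using closed[OF 8] that m by (simp add: return_b_def)
    fix y assume "y \<le> m - 5" "1 \<le> y - 2" "(1, y) \<in> A"
    then show "(1, y - 2) \<in> A" using generic[of y] by simp
  qed (use that m in simp_all)
  have column1: "(1, y) \<in> A" if "0 \<le> y" "y < m" for y
  proof -
    have "y \<noteq> m - 4" if "odd y" using that m(2) by auto
    then consider "y = m - 1" | "y = m - 2" | "y = m - 3" | "even y" "y \<le> m - 4" | "odd y" "y \<le> m - 5"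
      using \<open>y < m\<close> by fastforce
    then show ?thesis
    proof cases
      case 5
      then have "1 \<le> y" using \<open>0 \<le> y\<close> by (cases "y = 0") auto
      then show ?thesis using odds 5 by simp
    qed (use 1 3 7 evens that in simp_all)
  qed
  show "{0..<m} \<times> {0..<m} \<subseteq> A"
  proof clarify
    fix x y assume xy: "x \<in> {0..<m}" "y \<in> {0..<m}"
    show "(x, y) \<in> A"
    proof (cases "x = 0")
      case False
      \<comment> \<open>The cell \<open>(x, y)\<close> lies on the antidiagonal that starts at
        \<open>(1, y + x - 1)\<close> modulo \<open>m\<close>.\<close>
      have "((y + x - 1) mod m - x + 1) mod m = ((y + x - 1) mod m + (1 - x)) mod m"
        by (simp add: algebra_simps)
      also have "\<dots> = y" using xy by (simp only: mod_add_left_eq) simp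
      finally show ?thesis
        using antidiagonal[OF column1, of "(y + x - 1) mod m" x] xy False m by simp
    next
      case True
      consider "y = 0" | "y = 1" | "y = m - 1" | "y = m - 2" | "2 \<le> y" "y \<le> m - 3"
        using xy by fastforce
      then show ?thesis
        using generic[OF column1, of "y - 1"] xy True 2 5 6 8 by cases simp_all
    qed
  qed
qed

text \<open>
  Each column \<open>x\<close> with \<open>2 \<le> x < m - 1\<close> consists of two strands, entered at \<open>(x, 1)\<close> and at
  \<open>(x, m + 2 - x)\<close>, and the exit of either strand is the other entry of the next column. Since \<open>m\<close> is
  even, the two resulting paths from column \<open>2\<close> to column \<open>m - 1\<close> are joined via columns \<open>0\<close> and \<open>1\<close>
  into one cycle.
\<close>

lemma cyclic_on_return_c:
  fixes m :: int
  assumes m: "m \<ge> 4" "even m"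
  shows "cyclic_on (return_c m) ({0..<m} \<times> {0..<m})"
proof (rule cyclic_on_if_covered[of "(m - 1, 2)"])
  show "(m - 1, 2) \<in> {0..<m} \<times> {0..<m}" using m by simp
  show "return_c m v \<in> {0..<m} \<times> {0..<m}" if "v \<in> {0..<m} \<times> {0..<m}" for v
    using that m by (auto simp: return_c_def)
  fix A assume start: "return_c m (m - 1, 2) \<in> A"
    and closed': "\<And>v. v \<in> {0..<m} \<times> {0..<m} \<Longrightarrow> v \<in> A \<Longrightarrow> return_c m v \<in> A"
  have closed: "return_c m (x, y) \<in> A" if "(x, y) \<in> A" "0 \<le> x" "x < m" "0 \<le> y" "y < m" for x y
    using closed' that by simp
  have step2: "(x, y + 2) \<in> A" if "(x, y) \<in> A" "x = 0 \<or> x = 1" "1 \<le> y" "y + 2 < m" for x y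
    using closed[OF that(1)] that m by (auto simp: return_c_def)
  \<comment> \<open>The even rows are met in the order \<open>2\<close>, \<open>4\<close>, up to
    \<open>m - 2\<close>, and row \<open>0\<close> comes last by wraparound.\<close>
  have evens: "(x, y) \<in> A" if "(x, 2) \<in> A" "x = 0 \<or> x = 1" "even y" "0 \<le> y" "y < m" for x y
  proof -
    have pos: "(x, y) \<in> A" if "even y" "2 \<le> y" "y \<le> m - 2" for y
    proof (rule up_induct[of "\<lambda>y. (x, y) \<in> A" 2 2 "m - 2"])
      fix y assume "2 \<le> y" "y + 2 \<le> m - 2" "(x, y) \<in> A"
      then show "(x, y + 2) \<in> A" using step2[of x y] \<open>x = 0 \<or> x = 1\<close> by simp
    qed (use that \<open>(x, 2) \<in> A\<close> in simp_all)
    have "(x, 0) \<in> A"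
      using closed[OF pos[of "m - 2"]] \<open>x = 0 \<or> x = 1\<close> m by (auto simp: return_c_def)
    moreover have "y \<noteq> m - 1" "y \<noteq> 1" using that(3) m(2) by auto
    ultimately show ?thesis using pos[of y] that by (cases "y = 0") simp_all
  qed
  have odds: "(x, y) \<in> A" if "(x, 1) \<in> A" "x = 0 \<or> x = 1" "odd y" "0 \<le> y" "y < m" for x y
  proof (rule up_induct[of "\<lambda>y. (x, y) \<in> A" 1 2 "m - 1"])
    show "1 \<le> y" using that(3,4) by (cases "y = 0") auto
    fix y assume "1 \<le> y" "y + 2 \<le> m - 1" "(x, y) \<in> A"
    then show "(x, y + 2) \<in> A" using step2[of x y] that(2) by simp
  qed (use that in simp_all)
  have up1: "(x, y + 1) \<in> A"
    if "(x, y) \<in> A" "2 \<le> x" "x < m" "1 \<le> y" "y + 1 < m" "x + y \<noteq> m + 1" "x \<noteq> m - 1 \<or> y \<noteq> 1" for x y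
    using closed[OF that(1)] that by (auto simp: return_c_def)
  have low: "(x, y) \<in> A" if "(x, 1) \<in> A" "2 \<le> x" "x < m - 1" "1 \<le> y" "y \<le> m + 1 - x" "y < m" for x y
  proof (rule up_induct[of "\<lambda>y. (x, y) \<in> A" 1 1 "min (m - 1) (m + 1 - x)"])
    fix y assume "1 \<le> y" "y + 1 \<le> min (m - 1) (m + 1 - x)" "(x, y) \<in> A"
    then show "(x, y + 1) \<in> A" using up1[of x y] that(2,3) by simp
  qed (use that in simp_all)
  \<comment> \<open>The upper strand climbs from row \<open>m + 2 - x\<close> to row
    \<open>m - 1\<close> and ends in row \<open>0\<close>. For \<open>x = 2\<close> its entry is
    already row \<open>0\<close>, hence the \<open>mod\<close>.\<close>
  have high: "(x, y) \<in> A"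
    if "(x, (m + 2 - x) mod m) \<in> A" "2 \<le> x" "x < m" "m + 2 - x \<le> y \<or> y = 0" "0 \<le> y" "y < m" for x y
  proof (cases "x = 2")
    case True
    then show ?thesis using that by auto
  next
    case False
    then have entry: "(x, m + 2 - x) \<in> A" using that by simp
    have high: "(x, y) \<in> A" if "m + 2 - x \<le> y" "y \<le> m - 1" for y
    proof (rule up_induct[of "\<lambda>y. (x, y) \<in> A" "m + 2 - x" 1 "m - 1"])
      fix y assume "m + 2 - x \<le> y" "y + 1 \<le> m - 1" "(x, y) \<in> A"
      then show "(x, y + 1) \<in> A" using up1[of x y] \<open>2 \<le> x\<close> \<open>x < m\<close> by simp
    qed (use that entry in simp_all)
    have "(x, 0) \<in> A"
      using closed[OF high[of "m - 1"]] \<open>2 \<le> x\<close> \<open>x < m\<close> False by (auto simp: return_c_def)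
    then show ?thesis using high[of y] that by auto
  qed
  have low_exit: "(x + 1, (m + 2 - (x + 1)) mod m) \<in> A" if "(x, 1) \<in> A" "2 \<le> x" "x < m - 1" for x
  proof -
    have "(x, m + 1 - x) \<in> A" using low[OF that, of "m + 1 - x"] that by simp
    then have "(x + 1, m + 1 - x) \<in> A"
      using closed[of x "m + 1 - x"] that by (simp add: return_c_def)
    moreover have "m + 2 - (x + 1) = m + 1 - x" "(m + 1 - x) mod m = m + 1 - x" using that by simp_all
    ultimately show ?thesis by (simp only:)
  qed
  have high_exit: "(x + 1, 1) \<in> A" if "(x, (m + 2 - x) mod m) \<in> A" "2 \<le> x" "x < m - 1" for x
    using closed[OF high[OF that(1), of 0]] that by (simp add: return_c_def)
  \<comment> \<open>From \<open>(2, 0)\<close> the path takes the upper strand in even columns and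
    the lower one in odd columns; from \<open>(2, 1)\<close> the roles are exchanged.\<close>
  have alternate: "(x, (m + 2 - x) mod m) \<in> A \<and> (x + 1, 1) \<in> A"
    if "even x" "2 \<le> x" "x \<le> m - 2" and "(2, 0) \<in> A" for x
  proof (rule up_induct[of "\<lambda>x. (x, (m + 2 - x) mod m) \<in> A \<and> (x + 1, 1) \<in> A" 2 2 "m - 2"])
    show "(2, (m + 2 - 2) mod m) \<in> A \<and> (2 + 1, 1) \<in> A"
      using that(4) high_exit[of 2] m by simp
    fix x assume "2 \<le> x" "x + 2 \<le> m - 2" "(x, (m + 2 - x) mod m) \<in> A \<and> (x + 1, 1) \<in> A"
    then show "(x + 2, (m + 2 - (x + 2)) mod m) \<in> A \<and> (x + 2 + 1, 1) \<in> A"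
      using low_exit[of "x + 1"] high_exit[of "x + 2"] by (simp add: add.assoc)
  qed (use that in simp_all)
  have alternate': "(x, 1) \<in> A \<and> (x + 1, (m + 2 - (x + 1)) mod m) \<in> A"
    if "even x" "2 \<le> x" "x \<le> m - 2" and "(2, 1) \<in> A" for x
  proof (rule up_induct[of "\<lambda>x. (x, 1) \<in> A \<and> (x + 1, (m + 2 - (x + 1)) mod m) \<in> A" 2 2 "m - 2"])
    show "(2, 1) \<in> A \<and> (2 + 1, (m + 2 - (2 + 1)) mod m) \<in> A"
      using that(4) low_exit[of 2] m by simp
    fix x assume "2 \<le> x" "x + 2 \<le> m - 2" "(x, 1) \<in> A \<and> (x + 1, (m + 2 - (x + 1)) mod m) \<in> A"
    then show "(x + 2, 1) \<in> A \<and> (x + 2 + 1, (m + 2 - (x + 2 + 1)) mod m) \<in> A"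
      using high_exit[of "x + 1"] low_exit[of "x + 2"] by (simp add: add.assoc)
  qed (use that in simp_all)
  have column0_even: "(0, y) \<in> A" if "even y" "0 \<le> y" "y < m" for y
    using evens[of 0 y] start that m by (simp add: return_c_def)
  have "(0, 1) \<in> A" using closed[OF column0_even[of 0]] m by (simp add: return_c_def)
  then have column0_odd: "(0, y) \<in> A" if "odd y" "0 \<le> y" "y < m" for y
    using odds[of 0 y] that by simp
  have "(1, 1) \<in> A" using closed[OF column0_odd[of "m - 1"]] m by (simp add: return_c_def)
  then have column1_odd: "(1, y) \<in> A" if "odd y" "0 \<le> y" "y < m" for y
    using odds[of 1 y] that by simp
  have "(2, 0) \<in> A" using closed[OF column1_odd[of "m - 1"]] m by (simp add: return_c_def)
  note alternate = alternate[OF _ _ _ this]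
  \<comment> \<open>Since \<open>m - 1\<close> is odd, the first path ends on the lower strand, and
    this corner leads back to the even rows of column \<open>1\<close>.\<close>
  have corner: "(m - 1, 1) \<in> A" using alternate[of "m - 2"] m by simp
  have "(1, 2) \<in> A" using closed[OF corner] m by (simp add: return_c_def)
  then have column1_even: "(1, y) \<in> A" if "even y" "0 \<le> y" "y < m" for y
    using evens[of 1 y] that by simp
  have "(2, 1) \<in> A" using closed[OF column1_even[of 0]] m by (simp add: return_c_def)
  note alternate' = alternate'[OF _ _ _ this]
  have low_entry: "(x, 1) \<in> A" if "2 \<le> x" "x \<le> m - 1" for x
  proof (cases "even x")
    case True
    then have "x \<noteq> m - 1" using m(2) by auto
    then show ?thesis using alternate'[of x] True that by simp
  next
    case False
    then have "x \<noteq> 2" by auto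
    then show ?thesis using alternate[of "x - 1"] False that by simp
  qed
  have high_entry: "(x, (m + 2 - x) mod m) \<in> A" if "2 \<le> x" "x \<le> m - 1" for x
  proof (cases "even x")
    case True
    then have "x \<noteq> m - 1" using m(2) by auto
    then show ?thesis using alternate[of x] True that by simp
  next
    case False
    then have "x \<noteq> 2" by auto
    then show ?thesis using alternate'[of "x - 1"] False that by simp
  qed
  \<comment> \<open>The second path ends on the upper strand of column \<open>m - 1\<close>, whose
    last cell \<open>(m - 1, 0)\<close> leads to the starting cell and closes the cycle.\<close>
  have last: "(m - 1, 2) \<in> A"
    using closed[OF high[OF high_entry, of "m - 1" 0]] m by (simp add: return_c_def)
  show "{0..<m} \<times> {0..<m} \<subseteq> A"
  proof clarify
    fix x y assume xy: "x \<in> {0..<m}" "y \<in> {0..<m}"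
    consider "x = 0" | "x = 1" | "2 \<le> x" "m + 2 - x \<le> y \<or> y = 0" | "2 \<le> x" "x < m - 1" "1 \<le> y" "y \<le> m + 1 - x"
      | "x = m - 1" "y = 1" | "x = m - 1" "y = 2"
      using xy by fastforce
    then show "(x, y) \<in> A"
    proof cases
      case 1
      then show ?thesis using column0_even column0_odd xy by (cases "even y") simp_all
    next
      case 2
      then show ?thesis using column1_even column1_odd xy by (cases "even y") simp_all
    next
      case 3
      then show ?thesis using high[OF high_entry, of x y] xy by simp
    next
      case 4
      then show ?thesis using low[OF low_entry, of x y] xy by simp
    qed (use corner last in simp_all)
  qed
qed

lemma cyclic_on_even:
  fixes m :: int
  assumes m: "m \<ge> 4" "even m"
  shows "cyclic_on (\<lambda>v. add3 m v (case v of (x, y, z) \<Rightarrow> fst (even_dirs m ((x + y + z) mod m) x y))) (Zm3 m)"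
    and "cyclic_on (\<lambda>v. add3 m v (case v of (x, y, z) \<Rightarrow> fst (snd (even_dirs m ((x + y + z) mod m) x y)))) (Zm3 m)"
    and "cyclic_on (\<lambda>v. add3 m v (case v of (x, y, z) \<Rightarrow> snd (snd (even_dirs m ((x + y + z) mod m) x y)))) (Zm3 m)"
proof -
  let ?Y = "{0..<m} \<times> {0..<m}"
  have "cyclic_on (layer_return m (\<lambda>s x y. fst (even_dirs m s x y)) e1) ?Y"
    using cyclic_on_return_a[OF m] layer_return_a[OF m(1)] by (subst cyclic_cong) auto
  then show "cyclic_on (\<lambda>v. add3 m v (case v of (x, y, z) \<Rightarrow> fst (even_dirs m ((x + y + z) mod m) x y))) (Zm3 m)"
    using m by (intro cyclic_on_if_return) (auto simp: even_dirs_def)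
  have "cyclic_on (layer_return m (\<lambda>s x y. fst (snd (even_dirs m s x y))) e2) ?Y"
    using cyclic_on_return_b[OF m] layer_return_b[OF m(1)] by (subst cyclic_cong) auto
  then show "cyclic_on (\<lambda>v. add3 m v (case v of (x, y, z) \<Rightarrow> fst (snd (even_dirs m ((x + y + z) mod m) x y)))) (Zm3 m)"
    using m by (intro cyclic_on_if_return) (auto simp: even_dirs_def)
  have "cyclic_on (layer_return m (\<lambda>s x y. snd (snd (even_dirs m s x y))) e3) ?Y"
    using cyclic_on_return_c[OF m] layer_return_c[OF m(1)] by (subst cyclic_cong) auto
  then show "cyclic_on (\<lambda>v. add3 m v (case v of (x, y, z) \<Rightarrow> snd (snd (even_dirs m ((x + y + z) mod m) x y)))) (Zm3 m)"
    using m by (intro cyclic_on_if_return) (auto simp: even_dirs_def)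
qed

theorem theorem1p1:
  fixes m :: int
  assumes "m \<ge> 3"
  shows "\<exists>C1 C2 C3.
    pre_digraph.hamilton_cycle (with_proj (D3 m)) C1 \<and>
    pre_digraph.hamilton_cycle (with_proj (D3 m)) C2 \<and>
    pre_digraph.hamilton_cycle (with_proj (D3 m)) C3 \<and>
    set C1 \<inter> set C2 = {} \<and> set C1 \<inter> set C3 = {} \<and> set C2 \<inter> set C3 = {} \<and>
    set C1 \<union> set C2 \<union> set C3 = arcs (with_proj (D3 m))"
proof (cases "even m")
  case False
  let ?d = "\<lambda>P v. case v of (x, y, z) \<Rightarrow> P (odd_dirs m ((x + y + z) mod m) ((x + y) mod m))"
  show ?thesis
  proof (rule hamilton_decomposition_if_cyclic_on[of m "?d fst" "?d (\<lambda>t. fst (snd t))" "?d (\<lambda>t. snd (snd t))"])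
    show "{?d fst v, ?d (\<lambda>t. fst (snd t)) v, ?d (\<lambda>t. snd (snd t)) v} = {e1, e2, e3}" for v
      by (cases v) (simp add: odd_dirs_set)
  qed (use assms in simp, (rule cyclic_on_odd[OF assms False]; blast)+)
next
  case True
  let ?d = "\<lambda>P v. case v of (x, y, z) \<Rightarrow> P (even_dirs m ((x + y + z) mod m) x y)"
  have m: "m \<ge> 4" using assms True by (cases "m = 3") auto
  show ?thesis
  proof (rule hamilton_decomposition_if_cyclic_on[of m "?d fst" "?d (\<lambda>t. fst (snd t))" "?d (\<lambda>t. snd (snd t))"])
    show "{?d fst v, ?d (\<lambda>t. fst (snd t)) v, ?d (\<lambda>t. snd (snd t)) v} = {e1, e2, e3}" for v
      by (cases v) (simp add: even_dirs_set)
  qed (use assms in simp, (rule cyclic_on_even[OF m True])+)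
qed

end
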